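(* Let $G=(V,E)$ range over a sequence of finite connected graphs with $n=|V|\to\infty$, and consider the interchange process on $G$. Assume that $1-\gamma$, where $\gamma=o(1/n)$, is the second largest eigenvalue of the transition matrix for the motion of a single card under the interchange process on $G$. Let $\xi:V\to\mathbb{R}$ be a corresponding eigenvector with $\|\xi\|_2=1$, and assume that $\|\xi\|_1\ge n^a$ for some constant $a>0$ (not depending on $n$). Then $$\tau_{\mathrm{mix}}=\Omega(\gamma^{-1}\log n).$$
   Context: **Interchange process.** Let $G=(V,E)$ be a finite connected (simple) graph with $n=|V|$, $m=|E|$. Place $n$ distinct cards on the vertices, one per vertex, in a fixed initial arrangement. At each discrete time step an edge $e\in E$ is chosen uniformly at random, independently of everything else, and with probability $1/2$ (independently) the two cards at the end vertices of $e$ are switched; otherwise nothing changes. This is an irreducible aperiodic Markov chain $\{X_t\}$ on the $n!$ arrangements, with uniform stationary distribution $\pi$. **Single-card motion.** Under the interchange process any given card performs a Markov chain on $V$: from $u$ it stays at $u$ with probability $1-d_u/(2m)$ and moves to each neighbour $v$ of $u$ with probability $1/(2m)$, where $d_u$ is the degree of $u$. Its transition matrix $A$ is symmetric; eigenvalues are counted with multiplicity, the largest being $1$. **Mixing time.** $\tau_{\mathrm{mix}}=\min\{t:\|\mathbb{P}(X_t\in\cdot)-\pi\|_{TV}\le\frac14\}$, where $\|\nu\|_{TV}=\frac12\sum_i|\nu(i)|$ (this does not depend on the fixed initial arrangement). **Norms and notation.** For $\xi:V\to\mathbb{R}$, $\|\xi\|_2=\big(\sum_{v\in V}\xi(v)^2\big)^{1/2}$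 and $\|\xi\|_1=\sum_{v\in V}|\xi(v)|$. $f=o(g)$ means $f/g\to0$; $f=\Omega(g)$ means that $g\le Cf$ for some constant $C<\infty$ not depending on $n$. *)

theory Defs
  imports
    "HOL-Probability.Probability_Mass_Function"
    "HOL-Library.Landau_Symbols"
    "HOL-Combinatorics.Permutations"
    "HOL-Computational_Algebra.Fundamental_Theorem_Algebra"
    "Jordan_Normal_Form.Char_Poly"
begin

text \<open>A graph is given by its vertex set \<open>V\<close> and its set \<open>E\<close> of edges, each edge being the
  two-element set of its end vertices.\<close>

definition connected_simple_graph :: "'v set \<Rightarrow> 'v set set \<Rightarrow> bool" where
  "connected_simple_graph V E \<longleftrightarrow>
     finite V \<and> V \<noteq> {} \<and> (\<forall>e\<in>E. e \<subseteq> V \<and> card e = 2) \<and>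
     (\<forall>u\<in>V. \<forall>v\<in>V. (u, v) \<in> {(x, y). {x, y} \<in> E}\<^sup>*)"

definition degree_of :: "'v set set \<Rightarrow> 'v \<Rightarrow> nat" where
  "degree_of E u = card {e \<in> E. u \<in> e}"

definition card_motion :: "'v set set \<Rightarrow> 'v \<Rightarrow> 'v \<Rightarrow> real" where
  "card_motion E u v =
     (if u = v then 1 - real (degree_of E u) / (2 * real (card E))
      else if {u, v} \<in> E then 1 / (2 * real (card E))
      else 0)"

text \<open>The library's matrices are indexed by \<open>0, \<dots>, n - 1\<close>, so an enumeration of the
  vertices is chosen; the characteristic polynomial does not depend on this choice.\<close>

definition vertex_list :: "'v set \<Rightarrow> 'v list" where
  "vertex_list V = (SOME vs. set vs = V \<and> distinct vs)"

definition card_motion_mat :: "'v set \<Rightarrow> 'v set set \<Rightarrow> real mat" where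
  "card_motion_mat V E =
     mat (card V) (card V) (\<lambda>(i, j). card_motion E (vertex_list V ! i) (vertex_list V ! j))"

text \<open>Eigenvalues in decreasing order, repeated according to multiplicity. Since the matrix is
  real symmetric, all roots of its characteristic polynomial are real.\<close>

definition card_motion_spectrum :: "'v set \<Rightarrow> 'v set set \<Rightarrow> real list" where
  "card_motion_spectrum V E =
     rev (sorted_list_of_multiset (proots (char_poly (card_motion_mat V E))))"

text \<open>Positions in a list are counted from \<open>0\<close>. The length condition makes the predicate false
  for a one-vertex graph, which has no second eigenvalue.\<close>

definition second_largest_eigenvalue :: "'v set \<Rightarrow> 'v set set \<Rightarrow> real \<Rightarrow> bool" where
  "second_largest_eigenvalue V E \<mu> \<longleftrightarrow>
     1 < length (card_motion_spectrum V E) \<and> card_motion_spectrum V E ! 1 = \<mu>"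

definition card_motion_eigenvector ::
    "'v set \<Rightarrow> 'v set set \<Rightarrow> real \<Rightarrow> ('v \<Rightarrow> real) \<Rightarrow> bool" where
  "card_motion_eigenvector V E \<mu> \<xi> \<longleftrightarrow>
     (\<exists>v\<in>V. \<xi> v \<noteq> 0) \<and> (\<forall>u\<in>V. (\<Sum>v\<in>V. card_motion E u v * \<xi> v) = \<mu> * \<xi> u)"

text \<open>The \<open>n\<close> cards are named by the vertices. An arrangement is a permutation \<open>\<eta>\<close> of \<open>V\<close>
  (the identity outside \<open>V\<close>), where \<open>\<eta> v\<close> is the card lying at the vertex \<open>v\<close>.\<close>

definition arrangements :: "'v set \<Rightarrow> ('v \<Rightarrow> 'v) set" where
  "arrangements V = {\<eta>. \<eta> permutes V}"

definition switch :: "'v set \<Rightarrow> ('v \<Rightarrow> 'v) \<Rightarrow> 'v \<Rightarrow> 'v" where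
  "switch e \<eta> = (\<lambda>w. if w \<in> e then \<eta> (the_elem (e - {w})) else \<eta> w)"

lemma switch_pair:
  assumes "u \<noteq> v"
  shows "switch {u, v} \<eta> = \<eta> \<circ> Transposition.transpose u v"
proof
  fix w
  have "{u, v} - {u} = {v}" "{u, v} - {v} = {u}" using assms by auto
  then show "switch {u, v} \<eta> w = (\<eta> \<circ> Transposition.transpose u v) w"
    by (auto simp: switch_def Transposition.transpose_def)
qed

definition interchange_step :: "'v set set \<Rightarrow> ('v \<Rightarrow> 'v) \<Rightarrow> ('v \<Rightarrow> 'v) pmf" where
  "interchange_step E \<eta> =
     bind_pmf (pmf_of_set E) (\<lambda>e.
     bind_pmf (bernoulli_pmf (1 / 2)) (\<lambda>b.
     return_pmf (if b then switch e \<eta> else \<eta>)))"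

text \<open>The law of \<open>X\<^sub>t\<close> when the initial arrangement is \<open>\<eta>\<^sub>0\<close>.\<close>

primrec interchange_law :: "'v set set \<Rightarrow> ('v \<Rightarrow> 'v) \<Rightarrow> nat \<Rightarrow> ('v \<Rightarrow> 'v) pmf" where
  "interchange_law E \<eta>\<^sub>0 0 = return_pmf \<eta>\<^sub>0"
| "interchange_law E \<eta>\<^sub>0 (Suc t) = bind_pmf (interchange_law E \<eta>\<^sub>0 t) (interchange_step E)"

definition tv_norm :: "'s set \<Rightarrow> ('s \<Rightarrow> real) \<Rightarrow> real" where
  "tv_norm S \<nu> = (1 / 2) * (\<Sum>i\<in>S. \<bar>\<nu> i\<bar>)"

definition mixing_time :: "'v set \<Rightarrow> 'v set set \<Rightarrow> ('v \<Rightarrow> 'v) \<Rightarrow> nat" where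
  "mixing_time V E \<eta>\<^sub>0 =
     (LEAST t. tv_norm (arrangements V)
        (\<lambda>\<eta>. pmf (interchange_law E \<eta>\<^sub>0 t) \<eta> - pmf (pmf_of_set (arrangements V)) \<eta>) \<le> 1 / 4)"

end

theory Submission
  imports Defs
begin

text \<open>Wilson's method. Colour the cards that start at vertices where \<open>\<xi>\<close> is positive and let
  \<open>\<Phi>\<close> be the sum of \<open>\<xi>\<close> over the positions of the coloured cards. By linearity
  \<open>\<Phi>\<close> decays in mean exactly by the factor \<open>1 - \<gamma>\<close> per step. The mean square of its
  increment is at most the Dirichlet form of \<open>\<xi>\<close>, which is of order \<open>\<gamma>\<close>, so
  \<open>\<Phi>\<close> has variance at most \<open>1 / 2\<close> at all times, and second moment at most \<open>1 / 2\<close> in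
  equilibrium by stationarity. Since \<open>\<Phi>\<close> starts at half the \<open>1\<close>-norm of \<open>\<xi>\<close>, Chebyshev's
  inequality distinguishes the law of \<open>\<Phi>\<close> from equilibrium as long as
  \<open>(1 - \<gamma>)^t * n powr a \<ge> 6\<close>. Convergence to equilibrium is needed as well: without it the
  \<open>LEAST\<close> in the mixing time would be an unspecified number.\<close>

section \<open>Edge switches as involutions of the vertices, and total variation\<close>

definition partner :: "'v set \<Rightarrow> 'v \<Rightarrow> 'v" where
  "partner e w = (if w \<in> e then the_elem (e - {w}) else w)"

lemma switch_eq_comp: "switch e \<eta> = \<eta> \<circ> partner e"
  by (auto simp: fun_eq_iff switch_def partner_def)

lemma partner_pair:
  assumes "u \<noteq> v"
  shows "partner {u, v} = Transposition.transpose u v"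
  using switch_pair[OF assms, of id] switch_eq_comp[of "{u, v}" id] by simp

text \<open>Both laws have mass 1 on \<open>S\<close>, so the differences summed over
  \<open>A \<inter> S\<close> and over \<open>S - A\<close> are opposite. The gap is thus half of
  the first sum minus the second, which explains the factor \<open>1 / 2\<close>.\<close>

lemma prob_diff_le_tv_norm:
  assumes S: "finite S" "set_pmf p \<subseteq> S" "set_pmf q \<subseteq> S"
  shows "measure_pmf.prob p A - measure_pmf.prob q A \<le> tv_norm S (\<lambda>x. pmf p x - pmf q x)"
proof -
  have *: "measure_pmf.prob r A = sum (pmf r) (A \<inter> S)" if "set_pmf r \<subseteq> S" for r
  proof -
    have "measure_pmf.prob r A = measure_pmf.prob r (A \<inter> S)"
      using that by (intro measure_pmf.finite_measure_eq_AE) (auto simp: AE_measure_pmf_iff)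
    also have "\<dots> = sum (pmf r) (A \<inter> S)"
      using S by (intro measure_measure_pmf_finite) auto
    finally show ?thesis .
  qed
  let ?d = "\<lambda>x. pmf p x - pmf q x"
  have split: "sum h S = sum h (A \<inter> S) + sum h (S - A)" for h :: "'a \<Rightarrow> real"
    using S by (subst sum.Int_Diff[of S h A]) (auto simp: Int_commute)
  have "sum ?d S = 0"
    using sum_pmf_eq_1[OF S(1,2)] sum_pmf_eq_1[OF S(1,3)] by (simp add: sum_subtractf)
  with split[of ?d] have "sum ?d (A \<inter> S) = - sum ?d (S - A)" by simp
  moreover have "sum ?d (A \<inter> S) \<le> (\<Sum>x\<in>A \<inter> S. \<bar>?d x\<bar>)" by (intro sum_mono) auto
  moreover have "- sum ?d (S - A) \<le> (\<Sum>x\<in>S - A. \<bar>?d x\<bar>)"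
    unfolding sum_negf[symmetric] by (intro sum_mono) auto
  moreover have "measure_pmf.prob p A - measure_pmf.prob q A = sum ?d (A \<inter> S)"
    using *[OF S(2)] *[OF S(3)] by (simp add: sum_subtractf)
  ultimately show ?thesis
    using split[of "\<lambda>x. \<bar>?d x\<bar>"] by (simp add: tv_norm_def)
qed

section \<open>The chain on arrangements and its stationary law\<close>

locale interchange =
  fixes V :: "'v set" and E :: "'v set set"
  assumes graph: "connected_simple_graph V E"
    and E_nonempty: "E \<noteq> {}"
begin

lemma finite_V: "finite V"
  using graph by (simp add: connected_simple_graph_def)

lemma finite_E: "finite E"
proof (rule finite_subset)
  show "E \<subseteq> Pow V" using graph by (auto simp: connected_simple_graph_def)
qed (simp add: finite_V)

lemma card_E_pos: "real (card E) > 0"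
  using finite_E E_nonempty by (simp add: card_gt_0_iff)

lemma edgeE:
  assumes "e \<in> E"
  obtains x y where "e = {x, y}" "x \<noteq> y" "x \<in> V" "y \<in> V"
    "partner e = Transposition.transpose x y"
proof -
  have "e \<subseteq> V" "card e = 2" using graph assms by (auto simp: connected_simple_graph_def)
  then obtain x y where "e = {x, y}" "x \<noteq> y" by (auto simp: card_2_iff)
  with \<open>e \<subseteq> V\<close> that[of x y] show thesis by (auto simp: partner_pair)
qed

lemma card_V_ge_2: "card V \<ge> 2"
proof -
  obtain e where e: "e \<in> E" using E_nonempty by auto
  then have "e \<subseteq> V" "card e = 2" using graph by (auto simp: connected_simple_graph_def)
  then show ?thesis using card_mono[OF finite_V] by metis
qed

lemma partner_permutes: "e \<in> E \<Longrightarrow> partner e permutes V"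
  by (erule edgeE) (simp add: permutes_swap_id)

lemma partner_partner: "e \<in> E \<Longrightarrow> partner e (partner e w) = w"
  by (erule edgeE) simp

lemma sum_partner: "e \<in> E \<Longrightarrow> (\<Sum>v\<in>V. h (partner e v)) = (\<Sum>v\<in>V. h v)"
  using sum.permute[OF partner_permutes, of e h] by (simp add: o_def)

lemma switch_switch: "e \<in> E \<Longrightarrow> switch e (switch e \<eta>) = \<eta>"
  by (simp add: switch_eq_comp fun_eq_iff partner_partner)

lemma switch_arrangement: "e \<in> E \<Longrightarrow> \<eta> \<in> arrangements V \<Longrightarrow> switch e \<eta> \<in> arrangements V"
  using partner_permutes by (auto simp: arrangements_def switch_eq_comp intro: permutes_compose)

lemma finite_arrangements: "finite (arrangements V)"
  by (simp add: arrangements_def finite_permutations finite_V)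

lemma arrangements_nonempty: "arrangements V \<noteq> {}"
  using permutes_id[of V] unfolding arrangements_def by blast

lemma card_arrangements: "card (arrangements V) \<ge> 2"
proof -
  have "fact 2 \<le> (fact (card V) :: nat)" using card_V_ge_2 by (rule fact_mono)
  then show ?thesis
    using card_permutations[OF refl finite_V] by (simp add: arrangements_def)
qed

definition uniform :: "('v \<Rightarrow> 'v) pmf" where
  "uniform = pmf_of_set (arrangements V)"

lemma set_uniform: "set_pmf uniform = arrangements V"
  by (simp add: uniform_def set_pmf_of_set finite_arrangements arrangements_nonempty)

lemma interchange_step_alt:
  "interchange_step E \<eta> = bind_pmf (pmf_of_set E) (\<lambda>e.
     map_pmf (\<lambda>b. if b then switch e \<eta> else \<eta>) (bernoulli_pmf (1 / 2)))"
  by (simp add: interchange_step_def map_pmf_def)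

lemma set_interchange_step:
  "set_pmf (interchange_step E \<eta>) = insert \<eta> ((\<lambda>e. switch e \<eta>) ` E)"
  using E_nonempty finite_E
  by (auto simp: interchange_step_alt set_pmf_of_set set_pmf_bernoulli UNIV_bool)

lemma finite_law: "finite (set_pmf (interchange_law E \<eta> t))"
  by (induction t) (auto simp: set_interchange_step finite_E)

lemma law_arrangements:
  "\<eta> \<in> arrangements V \<Longrightarrow> set_pmf (interchange_law E \<eta> t) \<subseteq> arrangements V"
  by (induction t) (auto simp: set_interchange_step switch_arrangement)

lemma law_add:
  "interchange_law E \<eta> (s + t) = bind_pmf (interchange_law E \<eta> s) (\<lambda>x. interchange_law E x t)"
  by (induction t) (simp_all add: bind_assoc_pmf bind_return_pmf')

text \<open>For a fixed edge and coin the step is a bijection of the arrangements, since a switch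
  undoes itself; so it preserves the uniform law. Commuting the binds lets the edge and the coin be
  drawn first.\<close>

lemma uniform_step: "bind_pmf uniform (interchange_step E) = uniform"
proof -
  have inv: "map_pmf (\<lambda>\<eta>. if b then switch e \<eta> else \<eta>) uniform = uniform" if "e \<in> E" for e b
  proof (cases b)
    case True
    have "inj_on (switch e) (arrangements V)"
      by (rule inj_on_inverseI[of _ "switch e"]) (simp add: switch_switch that)
    moreover have "switch e ` arrangements V = arrangements V"
    proof (intro equalityI subsetI)
      fix \<eta> assume "\<eta> \<in> arrangements V"
      then have "switch e (switch e \<eta>) \<in> switch e ` arrangements V"
        using switch_arrangement[OF that] by blast
      then show "\<eta> \<in> switch e ` arrangements V" by (simp add: switch_switch that)
    qed (use switch_arrangement[OF that] in auto)
    ultimately have "map_pmf (switch e) uniform = uniform"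
      unfolding uniform_def
      by (subst map_pmf_of_set_inj) (auto simp: finite_arrangements arrangements_nonempty)
    with True show ?thesis by simp
  qed simp
  have "bind_pmf uniform (interchange_step E) =
      bind_pmf (pmf_of_set E) (\<lambda>e. bind_pmf (bernoulli_pmf (1 / 2)) (\<lambda>b.
        map_pmf (\<lambda>\<eta>. if b then switch e \<eta> else \<eta>) uniform))"
    unfolding interchange_step_def map_pmf_def
    by (subst bind_commute_pmf, subst (2) bind_commute_pmf) (rule refl)
  also have "\<dots> = bind_pmf (pmf_of_set E) (\<lambda>e. bind_pmf (bernoulli_pmf (1 / 2)) (\<lambda>b. uniform))"
    using E_nonempty finite_E inv by (intro bind_pmf_cong refl) (simp add: set_pmf_of_set)
  also have "\<dots> = uniform" by simp
  finally show ?thesis .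
qed

lemma uniform_law: "bind_pmf uniform (\<lambda>x. interchange_law E x t) = uniform"
  by (induction t)
     (simp_all add: bind_return_pmf' uniform_step flip: bind_assoc_pmf)

text \<open>The one-step transition operator acting on functions; the inner average is the fair
  coin.\<close>

definition step_mean :: "(('v \<Rightarrow> 'v) \<Rightarrow> real) \<Rightarrow> ('v \<Rightarrow> 'v) \<Rightarrow> real" where
  "step_mean f \<eta> = (\<Sum>e\<in>E. (f \<eta> + f (switch e \<eta>)) / 2) / real (card E)"

lemma expectation_interchange_step:
  "measure_pmf.expectation (interchange_step E \<eta>) f = step_mean f \<eta>"
  unfolding interchange_step_alt step_mean_def
  using E_nonempty finite_E
  by (subst pmf_expectation_bind_pmf_of_set)
     (auto simp: field_simps sum_divide_distrib sum.distrib)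

lemma expectation_bind_step:
  assumes "finite (set_pmf p)"
  shows "measure_pmf.expectation (bind_pmf p (interchange_step E)) f =
    measure_pmf.expectation p (step_mean f)"
proof -
  have "measure_pmf.expectation (bind_pmf p (interchange_step E)) f =
      (\<Sum>a\<in>set_pmf p. pmf p a *\<^sub>R measure_pmf.expectation (interchange_step E a) f)"
    using assms finite_E by (intro pmf_expectation_bind) (auto simp: set_interchange_step)
  also have "\<dots> = measure_pmf.expectation p (step_mean f)"
    using assms by (subst integral_measure_pmf[of "set_pmf p"])
      (auto simp: expectation_interchange_step)
  finally show ?thesis .
qed

section \<open>Irreducibility, aperiodicity and convergence to equilibrium\<close>

definition switch_rel :: "(('v \<Rightarrow> 'v) \<times> ('v \<Rightarrow> 'v)) set" where
  "switch_rel = {(\<eta>, switch e \<eta>) | \<eta> e. e \<in> E}"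

text \<open>Switches act on positions, hence by composition on the right. Demanding reachability
  from every \<open>\<eta>\<close> makes the property closed under composition.\<close>

definition realizable :: "('v \<Rightarrow> 'v) \<Rightarrow> bool" where
  "realizable \<sigma> \<longleftrightarrow> (\<forall>\<eta>. (\<eta>, \<eta> \<circ> \<sigma>) \<in> switch_rel\<^sup>*)"

lemma realizable_id: "realizable id"
  by (simp add: realizable_def)

lemma realizable_comp: "realizable \<sigma> \<Longrightarrow> realizable \<tau> \<Longrightarrow> realizable (\<sigma> \<circ> \<tau>)"
  unfolding realizable_def comp_assoc[symmetric] by (blast intro: rtrancl_trans)

lemma realizable_edge:
  assumes "{u, v} \<in> E"
  shows "realizable (Transposition.transpose u v)"
proof -
  have "u \<noteq> v" using graph assms by (auto simp: connected_simple_graph_def)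
  then have "(\<eta>, \<eta> \<circ> Transposition.transpose u v) \<in> switch_rel" for \<eta>
    using assms switch_pair[of u v \<eta>] unfolding switch_rel_def by force
  then show ?thesis unfolding realizable_def by (simp add: r_into_rtrancl)
qed

text \<open>Induction along a path from \<open>u\<close> to \<open>v\<close>: conjugating the
  transposition of a new edge \<open>{v, w}\<close> by that of \<open>u\<close> and \<open>v\<close>
  gives the one of \<open>u\<close> and \<open>w\<close>.\<close>

lemma realizable_transpose:
  assumes "u \<in> V" "v \<in> V"
  shows "realizable (Transposition.transpose u v)"
proof -
  have "(u, v) \<in> {(x, y). {x, y} \<in> E}\<^sup>*"
    using graph assms by (auto simp: connected_simple_graph_def)
  then show ?thesis
  proof (induction rule: rtrancl_induct)
    case base
    then show ?case using realizable_id by (simp add: id_def)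
  next
    case (step v w)
    then have vw: "realizable (Transposition.transpose v w)" by (auto intro: realizable_edge)
    \<comment> \<open>The conjugation identity needs distinct vertices; in the other cases the
      result is the identity, the edge transposition or the induction hypothesis.\<close>
    consider "u = w" | "u = v" | "u \<noteq> w" "v = w" | "u \<noteq> w" "u \<noteq> v" "v \<noteq> w" by blast
    then show ?case
    proof cases
      case 4
      then have "Transposition.transpose u v \<circ> Transposition.transpose v w \<circ>
          Transposition.transpose u v = Transposition.transpose u w"
        by (intro transpose_comp_triple) auto
      then show ?thesis using realizable_comp vw step.IH by metis
    qed (use vw step.IH realizable_id in \<open>auto simp: id_def\<close>)
  qed
qed

lemma realizable_permutes:
  assumes "\<sigma> permutes V"
  shows "realizable \<sigma>"
  using assms finite_V
proof (induction rule: permutes_induct)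
  case id
  show ?case by (rule realizable_id)
next
  case (swap a b p)
  then show ?case by (intro realizable_comp realizable_transpose)
qed

lemma arrangements_connected:
  assumes "\<eta> \<in> arrangements V" "\<eta>' \<in> arrangements V"
  shows "(\<eta>, \<eta>') \<in> switch_rel\<^sup>*"
proof -
  have p: "\<eta> permutes V" "\<eta>' permutes V" using assms by (auto simp: arrangements_def)
  then have "realizable (inv_into UNIV \<eta> \<circ> \<eta>')"
    by (intro realizable_permutes permutes_compose permutes_inv)
  then have "(\<eta>, \<eta> \<circ> (inv_into UNIV \<eta> \<circ> \<eta>')) \<in> switch_rel\<^sup>*" by (simp add: realizable_def)
  then show ?thesis using permutes_inv_o(1)[OF p(1)] by (simp flip: comp_assoc)
qed

lemma law_reaches:
  assumes "(\<eta>, \<eta>') \<in> switch_rel\<^sup>*"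
  shows "\<exists>t. \<eta>' \<in> set_pmf (interchange_law E \<eta> t)"
  using assms
proof (induction rule: rtrancl_induct)
  case base
  have "\<eta> \<in> set_pmf (interchange_law E \<eta> 0)" by simp
  then show ?case by blast
next
  case (step \<eta>\<^sub>1 \<eta>\<^sub>2)
  then obtain t e where "\<eta>\<^sub>1 \<in> set_pmf (interchange_law E \<eta> t)" "e \<in> E" "\<eta>\<^sub>2 = switch e \<eta>\<^sub>1"
    by (auto simp: switch_rel_def)
  then have "\<eta>\<^sub>2 \<in> set_pmf (interchange_law E \<eta> (Suc t))"
    by (auto simp: set_interchange_step)
  then show ?case by blast
qed

text \<open>The coin lets the chain stay put, so no reached arrangement is ever lost. This replaces
  an appeal to aperiodicity.\<close>

lemma set_law_mono:
  assumes "s \<le> t"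
  shows "set_pmf (interchange_law E \<eta> s) \<subseteq> set_pmf (interchange_law E \<eta> t)"
  using assms by (rule lift_Suc_mono_le[rotated]) (auto simp: set_interchange_step)

lemma law_positive:
  obtains T \<delta> where "\<delta> > 0"
    "\<And>\<eta> \<eta>'. \<eta> \<in> arrangements V \<Longrightarrow> \<eta>' \<in> arrangements V \<Longrightarrow> pmf (interchange_law E \<eta> T) \<eta>' \<ge> \<delta>"
proof -
  let ?S = "arrangements V \<times> arrangements V"
  have fin: "finite ?S" "?S \<noteq> {}" using finite_arrangements arrangements_nonempty by auto
  have "\<forall>p\<in>?S. \<exists>t. snd p \<in> set_pmf (interchange_law E (fst p) t)"
    using arrangements_connected law_reaches by auto
  then obtain t where t: "\<And>p. p \<in> ?S \<Longrightarrow> snd p \<in> set_pmf (interchange_law E (fst p) (t p))"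
    by metis
  \<comment> \<open>There are finitely many pairs and supports never shrink, so the latest of the
    hitting times works for all pairs at once.\<close>
  define T where "T = Max (t ` ?S)"
  define K where "K p = pmf (interchange_law E (fst p) T) (snd p)" for p
  have K: "K p > 0" if "p \<in> ?S" for p
  proof -
    have "t p \<le> T" unfolding T_def using fin that by (intro Max_ge) auto
    then have "snd p \<in> set_pmf (interchange_law E (fst p) T)"
      using t[OF that] set_law_mono by blast
    then show ?thesis by (simp add: K_def pmf_positive)
  qed
  show thesis
  proof (rule that[of "Min (K ` ?S)" T])
    show "Min (K ` ?S) > 0" using fin K by (subst Min_gr_iff) auto
    fix \<eta> \<eta>' assume "\<eta> \<in> arrangements V" "\<eta>' \<in> arrangements V"
    then have "Min (K ` ?S) \<le> K (\<eta>, \<eta>')" using fin by (intro Min_le) auto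
    then show "pmf (interchange_law E \<eta> T) \<eta>' \<ge> Min (K ` ?S)" by (simp add: K_def)
  qed
qed

text \<open>Doeblin's argument: subtracting \<open>\<delta>\<close> from every entry of a transition matrix does not change
  its action on vectors of total mass \<open>0\<close>, but lowers its row sums to \<open>1 - card S * \<delta>\<close>.\<close>

lemma kernel_contraction:
  fixes K :: "'s \<Rightarrow> 's \<Rightarrow> real"
  assumes S: "finite S" and "sum \<nu> S = 0"
    and row: "\<And>x. x \<in> S \<Longrightarrow> (\<Sum>y\<in>S. K x y) = 1"
    and K: "\<And>x y. x \<in> S \<Longrightarrow> y \<in> S \<Longrightarrow> K x y \<ge> \<delta>"
  shows "(\<Sum>y\<in>S. \<bar>\<Sum>x\<in>S. \<nu> x * K x y\<bar>) \<le> (1 - real (card S) * \<delta>) * (\<Sum>x\<in>S. \<bar>\<nu> x\<bar>)"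
proof -
  have "(\<Sum>y\<in>S. \<bar>\<Sum>x\<in>S. \<nu> x * K x y\<bar>) = (\<Sum>y\<in>S. \<bar>\<Sum>x\<in>S. \<nu> x * (K x y - \<delta>)\<bar>)"
    using assms(2)
    by (simp add: right_diff_distrib sum_subtractf sum_distrib_right[symmetric])
  also have "\<dots> \<le> (\<Sum>y\<in>S. \<Sum>x\<in>S. \<bar>\<nu> x\<bar> * (K x y - \<delta>))"
  proof (intro sum_mono)
    fix y assume "y \<in> S"
    have "\<bar>\<Sum>x\<in>S. \<nu> x * (K x y - \<delta>)\<bar> \<le> (\<Sum>x\<in>S. \<bar>\<nu> x * (K x y - \<delta>)\<bar>)" by (rule sum_abs)
    also have "\<dots> = (\<Sum>x\<in>S. \<bar>\<nu> x\<bar> * (K x y - \<delta>))"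
      using K \<open>y \<in> S\<close> by (intro sum.cong refl) (simp add: abs_mult)
    finally show "\<bar>\<Sum>x\<in>S. \<nu> x * (K x y - \<delta>)\<bar> \<le> (\<Sum>x\<in>S. \<bar>\<nu> x\<bar> * (K x y - \<delta>))" .
  qed
  also have "\<dots> = (\<Sum>x\<in>S. \<bar>\<nu> x\<bar> * (\<Sum>y\<in>S. K x y - \<delta>))"
    by (subst sum.swap) (simp add: sum_distrib_left)
  also have "\<dots> = (\<Sum>x\<in>S. \<bar>\<nu> x\<bar> * (1 - real (card S) * \<delta>))"
    using row by (intro sum.cong refl) (simp add: sum_subtractf)
  finally show ?thesis by (simp add: sum_distrib_right mult.commute)
qed

text \<open>Twice the total variation distance from equilibrium at time \<open>t\<close>.\<close>

definition law_deviation :: "('v \<Rightarrow> 'v) \<Rightarrow> nat \<Rightarrow> real" where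
  "law_deviation \<eta> t = (\<Sum>y\<in>arrangements V. \<bar>pmf (interchange_law E \<eta> t) y - pmf uniform y\<bar>)"

text \<open>Equilibrium is fixed by the \<open>T\<close>-step kernel, so that kernel carries the
  difference of the two laws forward, and \<open>kernel_contraction\<close> applies to it.\<close>

lemma law_deviation_contraction:
  assumes \<eta>: "\<eta> \<in> arrangements V"
    and K: "\<And>x y. x \<in> arrangements V \<Longrightarrow> y \<in> arrangements V \<Longrightarrow> pmf (interchange_law E x T) y \<ge> \<delta>"
  shows "law_deviation \<eta> (t + T) \<le> (1 - real (card (arrangements V)) * \<delta>) * law_deviation \<eta> t"
proof -
  let ?S = "arrangements V"
  let ?K = "\<lambda>x y. pmf (interchange_law E x T) y"
  have bind: "pmf (bind_pmf p (\<lambda>x. interchange_law E x T)) y = (\<Sum>x\<in>?S. pmf p x * ?K x y)"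
    if "set_pmf p \<subseteq> ?S" for p y
    unfolding pmf_bind
    using that finite_arrangements by (subst integral_measure_pmf[of ?S]) auto
  let ?\<nu> = "\<lambda>x. pmf (interchange_law E \<eta> t) x - pmf uniform x"
  have "sum ?\<nu> ?S = 0"
    using sum_pmf_eq_1[OF finite_arrangements law_arrangements[OF \<eta>]]
      sum_pmf_eq_1[OF finite_arrangements] set_uniform
    by (simp add: sum_subtractf)
  moreover have "(\<Sum>y\<in>?S. ?K x y) = 1" if "x \<in> ?S" for x
    using sum_pmf_eq_1[OF finite_arrangements law_arrangements[OF that]] .
  moreover have "pmf (interchange_law E \<eta> (t + T)) y - pmf uniform y = (\<Sum>x\<in>?S. ?\<nu> x * ?K x y)" for y
  proof -
    have "pmf uniform y = (\<Sum>x\<in>?S. pmf uniform x * ?K x y)"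
      using bind[of uniform y] set_uniform by (simp add: uniform_law)
    then show ?thesis
      using bind[OF law_arrangements[OF \<eta>], of t y]
      by (simp add: law_add sum_subtractf left_diff_distrib)
  qed
  ultimately show ?thesis
    unfolding law_deviation_def using kernel_contraction[OF finite_arrangements, of ?\<nu> ?K \<delta>] K by simp
qed

lemma law_converges:
  assumes \<eta>: "\<eta> \<in> arrangements V" and "\<epsilon> > 0"
  shows "\<exists>t. law_deviation \<eta> t \<le> \<epsilon>"
proof -
  obtain T \<delta> where \<delta>: "\<delta> > 0" and K: "\<And>x y. x \<in> arrangements V \<Longrightarrow> y \<in> arrangements V \<Longrightarrow>
      pmf (interchange_law E x T) y \<ge> \<delta>"
    by (rule law_positive) (rule that)
  let ?r = "1 - real (card (arrangements V)) * \<delta>"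
  \<comment> \<open>Summing the lower bound \<open>\<delta>\<close> over one row of the kernel shows
    that the contraction ratio is not negative.\<close>
  have "real (card (arrangements V)) * \<delta> = (\<Sum>y\<in>arrangements V. \<delta>)" by simp
  also have "\<dots> \<le> (\<Sum>y\<in>arrangements V. pmf (interchange_law E \<eta> T) y)"
    using K \<eta> by (intro sum_mono) auto
  also have "\<dots> = 1" using sum_pmf_eq_1[OF finite_arrangements law_arrangements[OF \<eta>]] .
  finally have "?r \<ge> 0" by simp
  moreover have "?r < 1" using \<delta> card_arrangements by simp
  ultimately have lim: "(\<lambda>j. ?r ^ j * law_deviation \<eta> 0) \<longlonglongrightarrow> 0 * law_deviation \<eta> 0"
    by (intro tendsto_mult LIMSEQ_realpow_zero tendsto_const)
  have dev: "law_deviation \<eta> (j * T) \<le> ?r ^ j * law_deviation \<eta> 0" for j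
  proof (induction j)
    case (Suc j)
    have "law_deviation \<eta> (j * T + T) \<le> ?r * law_deviation \<eta> (j * T)"
      by (rule law_deviation_contraction[OF \<eta> K])
    also have "\<dots> \<le> ?r * (?r ^ j * law_deviation \<eta> 0)"
      using Suc.IH \<open>?r \<ge> 0\<close> by (rule mult_left_mono)
    finally show ?case by (simp add: add.commute mult.assoc)
  qed simp
  have "\<exists>j. ?r ^ j * law_deviation \<eta> 0 < \<epsilon>"
    using order_tendstoD(2)[OF lim, of \<epsilon>] \<open>\<epsilon> > 0\<close> by (auto simp: eventually_sequentially)
  with dev show ?thesis by (meson le_less_trans less_imp_le)
qed

section \<open>The mixing time is attained and separates no event by more than 1/4\<close>

lemma tv_norm_mixing_time:
  assumes \<eta>: "\<eta> \<in> arrangements V"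
  shows "tv_norm (arrangements V) (\<lambda>x. pmf (interchange_law E \<eta> (mixing_time V E \<eta>)) x - pmf uniform x)
    \<le> 1 / 4"
proof -
  \<comment> \<open>A deviation of \<open>1 / 2\<close> is a total variation distance of
    \<open>1 / 4\<close>.\<close>
  have "\<exists>t. tv_norm (arrangements V) (\<lambda>x. pmf (interchange_law E \<eta> t) x - pmf uniform x) \<le> 1 / 4"
    using law_converges[OF \<eta>, of "1 / 2"] unfolding tv_norm_def law_deviation_def
    by (simp add: mult.commute)
  then show ?thesis unfolding mixing_time_def uniform_def by (rule LeastI_ex)
qed

text \<open>No event can separate two laws by more than their total variation distance. Later bounds
  on the mixing time come from exhibiting an event with a larger gap.\<close>

lemma mixing_time_separation:
  assumes "\<eta> \<in> arrangements V"
  shows "measure_pmf.prob (interchange_law E \<eta> (mixing_time V E \<eta>)) A - measure_pmf.prob uniform A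
    \<le> 1 / 4"
  using prob_diff_le_tv_norm[OF finite_arrangements law_arrangements[OF assms], of uniform]
  by (rule order_trans[OF _ tv_norm_mixing_time[OF assms]]) (simp add: set_uniform)

text \<open>A point mass is at distance at least 1/2 from a uniform law on two or more arrangements.
  This serves the finitely many graphs outside the asymptotic regime.\<close>

lemma mixing_time_pos:
  assumes \<eta>: "\<eta> \<in> arrangements V"
  shows "mixing_time V E \<eta> \<ge> 1"
proof (rule ccontr)
  assume "\<not> mixing_time V E \<eta> \<ge> 1"
  then have 0: "mixing_time V E \<eta> = 0" by simp
  have "measure_pmf.prob (interchange_law E \<eta> 0) {\<eta>} = 1" by (simp add: measure_pmf_single)
  moreover have "measure_pmf.prob uniform {\<eta>} \<le> 1 / 2"
    using \<eta> card_arrangements finite_arrangements arrangements_nonempty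
    by (simp add: measure_pmf_single uniform_def field_simps)
  ultimately show False using mixing_time_separation[OF \<eta>, of "{\<eta>}"] 0 by simp
qed

section \<open>Single-card motion as an average over edges\<close>

text \<open>Edges missing \<open>u\<close> contribute \<open>h u\<close>, and edges at
  \<open>u\<close> correspond to its neighbours. This puts the matrix into the same shape as
  \<open>step_mean\<close>.\<close>

lemma card_motion_sum:
  assumes u: "u \<in> V"
  shows "(\<Sum>v\<in>V. card_motion E u v * h v) = (\<Sum>e\<in>E. (h u + h (partner e u)) / 2) / real (card E)"
proof -
  let ?m = "real (card E)" and ?N = "{e \<in> E. u \<in> e}" and ?A = "{v \<in> V - {u}. {u, v} \<in> E}"
  have neighbours: "(\<Sum>e\<in>?N. h (partner e u)) = (\<Sum>v\<in>?A. h v)"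
  proof (rule sum.reindex_bij_witness[of _ "\<lambda>v. {u, v}" "\<lambda>e. partner e u"])
    fix e assume "e \<in> ?N"
    then have e: "e \<in> E" "u \<in> e" by auto
    from e(1) obtain x y where xy: "e = {x, y}" "x \<noteq> y" "x \<in> V" "y \<in> V"
      "partner e = Transposition.transpose x y" by (rule edgeE)
    then have "u = x \<or> u = y" using e by auto
    then show "{u, partner e u} = e" "partner e u \<in> ?A"
      using e xy by (auto simp: insert_commute)
  next
    fix v assume "v \<in> ?A"
    then show "partner {u, v} u = v" "{u, v} \<in> ?N" by (auto simp: partner_pair)
  qed simp
  have "(\<Sum>e\<in>E. h u + h (partner e u)) = 2 * ?m * h u + (\<Sum>e\<in>E. h (partner e u) - h u)"
    by (simp add: sum.distrib sum_subtractf)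
  also have "(\<Sum>e\<in>E. h (partner e u) - h u) = (\<Sum>e\<in>?N. h (partner e u) - h u)"
    using finite_E by (intro sum.mono_neutral_right) (auto simp: partner_def)
  also have "\<dots> = (\<Sum>v\<in>?A. h v) - real (degree_of E u) * h u"
    by (simp add: sum_subtractf neighbours degree_of_def)
  finally have rhs: "(\<Sum>e\<in>E. h u + h (partner e u)) =
      2 * ?m * h u + ((\<Sum>v\<in>?A. h v) - real (degree_of E u) * h u)" .
  have "(\<Sum>v\<in>V. card_motion E u v * h v) =
      card_motion E u u * h u + (\<Sum>v\<in>V - {u}. card_motion E u v * h v)"
    using u finite_V by (rule sum.remove[rotated])
  also have "(\<Sum>v\<in>V - {u}. card_motion E u v * h v) = (\<Sum>v\<in>?A. card_motion E u v * h v)"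
    using finite_V by (intro sum.mono_neutral_right) (auto simp: card_motion_def)
  also have "\<dots> = (\<Sum>v\<in>?A. h v) / (2 * ?m)"
    unfolding sum_divide_distrib by (intro sum.cong refl) (auto simp: card_motion_def)
  also have "card_motion E u u = 1 - real (degree_of E u) / (2 * ?m)"
    by (simp add: card_motion_def)
  also have "(1 - real (degree_of E u) / (2 * ?m)) * h u + (\<Sum>v\<in>?A. h v) / (2 * ?m) =
      (\<Sum>e\<in>E. h u + h (partner e u)) / (2 * ?m)"
    unfolding rhs using card_E_pos by (simp add: field_simps)
  finally have "(\<Sum>v\<in>V. card_motion E u v * h v) =
      (\<Sum>e\<in>E. h u + h (partner e u)) / (2 * ?m)" .
  then show ?thesis by (simp add: sum_divide_distrib[symmetric])
qed

lemma integrable_law: "integrable (measure_pmf (interchange_law E \<eta> t)) (f :: _ \<Rightarrow> real)"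
  by (rule integrable_measure_pmf_finite[OF finite_law])

lemma integrable_uniform: "integrable (measure_pmf uniform) (f :: _ \<Rightarrow> real)"
  by (rule integrable_measure_pmf_finite) (simp add: set_uniform finite_arrangements)

end

section \<open>The eigenvector and its Dirichlet form\<close>

text \<open>The bound \<open>\<gamma> \<le> 1 / 2\<close> keeps \<open>1 - 2 * \<gamma>\<close>
  nonnegative in the second-moment recursion and allows a linear lower bound on
  \<open>ln (1 - \<gamma>)\<close>.\<close>

locale interchange_eigen = interchange +
  fixes \<xi> :: "'a \<Rightarrow> real" and \<gamma> :: real
  assumes eigen: "\<And>u. u \<in> V \<Longrightarrow> (\<Sum>v\<in>V. card_motion E u v * \<xi> v) = (1 - \<gamma>) * \<xi> u"
    and norm2: "(\<Sum>v\<in>V. (\<xi> v)\<^sup>2) = 1"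
    and gamma_pos: "0 < \<gamma>" and gamma_le: "\<gamma> \<le> 1 / 2"
begin

lemma eigen_partner:
  assumes "u \<in> V"
  shows "(\<Sum>e\<in>E. \<xi> (partner e u) - \<xi> u) = - 2 * real (card E) * \<gamma> * \<xi> u"
proof -
  have "(1 - \<gamma>) * \<xi> u = (\<Sum>e\<in>E. \<xi> u + \<xi> (partner e u)) / 2 / real (card E)"
    using eigen[OF assms] card_motion_sum[OF assms, of \<xi>]
    by (simp add: sum_divide_distrib[symmetric])
  then have "(\<Sum>e\<in>E. \<xi> u + \<xi> (partner e u)) / 2 = real (card E) * ((1 - \<gamma>) * \<xi> u)"
    using card_E_pos by simp
  then show ?thesis by (simp add: sum.distrib sum_subtractf field_simps)
qed

text \<open>Each edge permutes \<open>V\<close>, so the differences cancel when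
  \<open>eigen_partner\<close> is summed over \<open>V\<close>; then divide by
  \<open>\<gamma>\<close>.\<close>

lemma eigen_sum: "(\<Sum>v\<in>V. \<xi> v) = 0"
proof -
  have "- 2 * real (card E) * \<gamma> * (\<Sum>u\<in>V. \<xi> u) = (\<Sum>u\<in>V. \<Sum>e\<in>E. \<xi> (partner e u) - \<xi> u)"
    by (simp add: eigen_partner sum_distrib_left)
  also have "\<dots> = (\<Sum>e\<in>E. \<Sum>u\<in>V. \<xi> (partner e u) - \<xi> u)" by (rule sum.swap)
  also have "\<dots> = 0" by (simp add: sum_subtractf sum_partner)
  finally show ?thesis using card_E_pos gamma_pos by simp
qed

text \<open>Summation by parts on each edge, followed by the eigenvector equation and
  \<open>norm2\<close>. Each edge is counted from both ends, so this is twice the sum of squared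
  differences over edges.\<close>

lemma dirichlet_form:
  "(\<Sum>e\<in>E. \<Sum>v\<in>V. (\<xi> (partner e v) - \<xi> v)\<^sup>2) = 4 * real (card E) * \<gamma>"
proof -
  have "(\<Sum>v\<in>V. (\<xi> (partner e v) - \<xi> v)\<^sup>2) = - 2 * (\<Sum>v\<in>V. \<xi> v * (\<xi> (partner e v) - \<xi> v))"
    if "e \<in> E" for e
  proof -
    have "(\<Sum>v\<in>V. (\<xi> (partner e v) - \<xi> v)\<^sup>2) =
        (\<Sum>v\<in>V. (\<xi> (partner e v))\<^sup>2 - (\<xi> v)\<^sup>2 + - 2 * (\<xi> v * (\<xi> (partner e v) - \<xi> v)))"
      by (intro sum.cong refl) (simp add: power2_eq_square algebra_simps)
    also have "\<dots> = - 2 * (\<Sum>v\<in>V. \<xi> v * (\<xi> (partner e v) - \<xi> v))"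
      unfolding sum.distrib sum_subtractf sum_partner[OF that, of "\<lambda>v. (\<xi> v)\<^sup>2"]
      by (simp add: sum_distrib_left)
    finally show ?thesis .
  qed
  then have "(\<Sum>e\<in>E. \<Sum>v\<in>V. (\<xi> (partner e v) - \<xi> v)\<^sup>2) =
      - 2 * (\<Sum>e\<in>E. \<Sum>v\<in>V. \<xi> v * (\<xi> (partner e v) - \<xi> v))"
    by (simp add: sum_distrib_left)
  also have "(\<Sum>e\<in>E. \<Sum>v\<in>V. \<xi> v * (\<xi> (partner e v) - \<xi> v)) =
      (\<Sum>v\<in>V. \<xi> v * (\<Sum>e\<in>E. \<xi> (partner e v) - \<xi> v))"
    by (subst sum.swap) (simp add: sum_distrib_left)
  also have "\<dots> = (\<Sum>v\<in>V. (- 2 * real (card E) * \<gamma>) * (\<xi> v)\<^sup>2)"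
    by (intro sum.cong refl) (simp add: eigen_partner power2_eq_square)
  also have "\<dots> = - 2 * real (card E) * \<gamma>"
    by (simp only: norm2 mult_1_right flip: sum_distrib_left)
  finally show ?thesis by simp
qed

section \<open>Drift and fluctuations of the observable\<close>

text \<open>\<open>g\<close> weights the cards and \<open>\<xi>\<close> the positions; the indicator
  of the coloured cards as \<open>g\<close> gives \<open>\<Phi>\<close>.\<close>

definition obs :: "('a \<Rightarrow> real) \<Rightarrow> ('a \<Rightarrow> 'a) \<Rightarrow> real" where
  "obs g \<eta> = (\<Sum>v\<in>V. g (\<eta> v) * \<xi> v)"

text \<open>Reindexing by the involution moves the switch from the cards to \<open>\<xi>\<close>,
  where the eigenvector equation can be used vertex by vertex.\<close>

lemma obs_switch:
  assumes "e \<in> E"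
  shows "obs g (switch e \<eta>) - obs g \<eta> = (\<Sum>v\<in>V. g (\<eta> v) * (\<xi> (partner e v) - \<xi> v))"
proof -
  have "obs g (switch e \<eta>) = (\<Sum>v\<in>V. g (\<eta> v) * \<xi> (partner e v))"
    using sum_partner[OF assms, of "\<lambda>v. g (\<eta> v) * \<xi> (partner e v)"]
    by (simp add: obs_def switch_eq_comp partner_partner assms)
  then show ?thesis by (simp add: obs_def right_diff_distrib sum_subtractf)
qed

lemma obs_drift: "(\<Sum>e\<in>E. obs g (switch e \<eta>) - obs g \<eta>) = - 2 * real (card E) * \<gamma> * obs g \<eta>"
proof -
  have "(\<Sum>e\<in>E. obs g (switch e \<eta>) - obs g \<eta>) =
      (\<Sum>v\<in>V. g (\<eta> v) * (\<Sum>e\<in>E. \<xi> (partner e v) - \<xi> v))"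
    by (simp add: obs_switch sum_distrib_left sum.swap[of _ E V])
  also have "\<dots> = (\<Sum>v\<in>V. - 2 * real (card E) * \<gamma> * (g (\<eta> v) * \<xi> v))"
    by (intro sum.cong refl) (simp add: eigen_partner)
  also have "\<dots> = - 2 * real (card E) * \<gamma> * obs g \<eta>"
    by (simp only: obs_def sum_distrib_left)
  finally show ?thesis .
qed

text \<open>Only the two ends of \<open>e\<close> matter: the jump is a difference of
  \<open>g\<close>, of size at most 1, times a difference of \<open>\<xi>\<close>. The halving
  undoes the double count of the edge.\<close>

lemma obs_jump:
  assumes e: "e \<in> E" and g: "\<And>c. 0 \<le> g c" "\<And>c. g c \<le> 1"
  shows "(obs g (switch e \<eta>) - obs g \<eta>)\<^sup>2 \<le> (\<Sum>v\<in>V. (\<xi> (partner e v) - \<xi> v)\<^sup>2) / 2"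
proof -
  obtain x y where xy: "e = {x, y}" "x \<noteq> y" "x \<in> V" "y \<in> V"
    "partner e = Transposition.transpose x y" using e by (rule edgeE)
  have restrict: "(\<Sum>v\<in>V. h v) = h x + h y" if "\<And>v. v \<noteq> x \<Longrightarrow> v \<noteq> y \<Longrightarrow> h v = 0" for h :: "'a \<Rightarrow> real"
    using sum.mono_neutral_right[of V "{x, y}" h] finite_V xy that by auto
  have "obs g (switch e \<eta>) - obs g \<eta> = (g (\<eta> x) - g (\<eta> y)) * (\<xi> y - \<xi> x)"
    unfolding obs_switch[OF e] xy(5) by (subst restrict) (auto simp: algebra_simps)
  moreover have "(\<Sum>v\<in>V. (\<xi> (partner e v) - \<xi> v)\<^sup>2) / 2 = (\<xi> y - \<xi> x)\<^sup>2"
    unfolding xy(5) by (subst restrict) (auto simp: power2_commute)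
  moreover have "(g (\<eta> x) - g (\<eta> y))\<^sup>2 \<le> 1"
    using g[of "\<eta> x"] g[of "\<eta> y"] by (simp add: abs_square_le_1 abs_le_iff)
  ultimately show ?thesis by (simp add: power_mult_distrib mult_left_le_one_le)
qed

lemma step_mean_obs: "step_mean (obs g) \<eta> = (1 - \<gamma>) * obs g \<eta>"
proof -
  have "(\<Sum>e\<in>E. (obs g \<eta> + obs g (switch e \<eta>)) / 2) =
      (\<Sum>e\<in>E. obs g \<eta> + (obs g (switch e \<eta>) - obs g \<eta>) / 2)"
    by (intro sum.cong refl) (simp add: field_simps)
  also have "\<dots> = real (card E) * obs g \<eta> - real (card E) * \<gamma> * obs g \<eta>"
    unfolding sum.distrib sum_divide_distrib[symmetric] obs_drift by simp
  finally show ?thesis using card_E_pos by (simp add: step_mean_def field_simps)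
qed

lemma step_mean_obs_square:
  assumes g: "\<And>c. 0 \<le> g c" "\<And>c. g c \<le> 1"
  shows "step_mean (\<lambda>\<eta>. (obs g \<eta>)\<^sup>2) \<eta> \<le> (1 - 2 * \<gamma>) * (obs g \<eta>)\<^sup>2 + \<gamma>"
proof -
  let ?d = "\<lambda>e. obs g (switch e \<eta>) - obs g \<eta>"
  have "(\<Sum>e\<in>E. ((obs g \<eta>)\<^sup>2 + (obs g (switch e \<eta>))\<^sup>2) / 2) =
      (\<Sum>e\<in>E. (obs g \<eta>)\<^sup>2 + obs g \<eta> * ?d e + (?d e)\<^sup>2 / 2)"
    by (intro sum.cong refl) (simp add: field_simps power2_eq_square)
  \<comment> \<open>The quarter combines the fair coin with the half in \<open>obs_jump\<close>;
    against the \<open>4\<close> in \<open>dirichlet_form\<close> it leaves exactly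
    \<open>\<gamma>\<close> per step.\<close>
  also have "\<dots> \<le> (\<Sum>e\<in>E. (obs g \<eta>)\<^sup>2 + obs g \<eta> * ?d e +
      (\<Sum>v\<in>V. (\<xi> (partner e v) - \<xi> v)\<^sup>2) / 4)"
    using obs_jump[OF _ g] by (intro sum_mono add_left_mono) (simp add: field_simps)
  also have "\<dots> = real (card E) * (obs g \<eta>)\<^sup>2 + obs g \<eta> * (- 2 * real (card E) * \<gamma> * obs g \<eta>) +
      4 * real (card E) * \<gamma> / 4"
    unfolding sum.distrib sum_divide_distrib[symmetric] sum_distrib_left[symmetric]
      dirichlet_form obs_drift by simp
  also have "\<dots> = ((1 - 2 * \<gamma>) * (obs g \<eta>)\<^sup>2 + \<gamma>) * real (card E)"
    by (simp add: algebra_simps power2_eq_square)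
  finally show ?thesis using card_E_pos unfolding step_mean_def by (simp add: pos_divide_le_eq)
qed

lemma expectation_obs:
  "measure_pmf.expectation (interchange_law E \<eta> t) (obs g) = (1 - \<gamma>) ^ t * obs g \<eta>"
proof (induction t)
  case (Suc t)
  have "step_mean (obs g) = (\<lambda>x. (1 - \<gamma>) * obs g x)" by (rule ext) (rule step_mean_obs)
  with Suc show ?case by (simp add: expectation_bind_step[OF finite_law])
qed simp

text \<open>\<open>1 / 2\<close> is the fixed point of the recursion
  \<open>s \<mapsto> (1 - 2 * \<gamma>) * s + \<gamma>\<close>.\<close>

lemma expectation_obs_square:
  assumes g: "\<And>c. 0 \<le> g c" "\<And>c. g c \<le> 1"
  shows "measure_pmf.expectation (interchange_law E \<eta> t) (\<lambda>x. (obs g x)\<^sup>2) \<le>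
    (1 - 2 * \<gamma>) ^ t * (obs g \<eta>)\<^sup>2 + 1 / 2"
proof (induction t)
  case (Suc t)
  let ?E = "measure_pmf.expectation (interchange_law E \<eta> t)"
  have "measure_pmf.expectation (interchange_law E \<eta> (Suc t)) (\<lambda>x. (obs g x)\<^sup>2) =
      ?E (step_mean (\<lambda>x. (obs g x)\<^sup>2))"
    by (simp add: expectation_bind_step[OF finite_law])
  also have "\<dots> \<le> ?E (\<lambda>x. (1 - 2 * \<gamma>) * (obs g x)\<^sup>2 + \<gamma>)"
    by (intro integral_mono integrable_law step_mean_obs_square g)
  also have "\<dots> = (1 - 2 * \<gamma>) * ?E (\<lambda>x. (obs g x)\<^sup>2) + \<gamma>"
    by (subst Bochner_Integration.integral_add) (auto intro: integrable_law)
  also have "\<dots> \<le> (1 - 2 * \<gamma>) * ((1 - 2 * \<gamma>) ^ t * (obs g \<eta>)\<^sup>2 + 1 / 2) + \<gamma>"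
    using Suc gamma_le by (intro add_right_mono mult_left_mono) auto
  finally show ?case by (simp add: algebra_simps)
qed simp

text \<open>Since \<open>1 - 2 * \<gamma> \<le> (1 - \<gamma>)^2\<close>, the squared mean absorbs
  the term carrying the initial value, and the bound is free of \<open>t\<close> and
  \<open>\<eta>\<close>.\<close>

lemma variance_obs:
  assumes g: "\<And>c. 0 \<le> g c" "\<And>c. g c \<le> 1"
  shows "measure_pmf.variance (interchange_law E \<eta> t) (obs g) \<le> 1 / 2"
proof -
  have "measure_pmf.variance (interchange_law E \<eta> t) (obs g) =
      measure_pmf.expectation (interchange_law E \<eta> t) (\<lambda>x. (obs g x)\<^sup>2) - ((1 - \<gamma>) ^ t * obs g \<eta>)\<^sup>2"
    by (subst measure_pmf.variance_eq[OF integrable_law integrable_law]) (simp add: expectation_obs)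
  also have "\<dots> \<le> (1 - 2 * \<gamma>) ^ t * (obs g \<eta>)\<^sup>2 + 1 / 2 - ((1 - \<gamma>)\<^sup>2) ^ t * (obs g \<eta>)\<^sup>2"
    using expectation_obs_square[of g \<eta> t, OF g]
    by (simp add: power_mult_distrib mult.commute[of 2] flip: power_mult)
  also have "(1 - 2 * \<gamma>) ^ t * (obs g \<eta>)\<^sup>2 \<le> ((1 - \<gamma>)\<^sup>2) ^ t * (obs g \<eta>)\<^sup>2"
    using gamma_le by (intro mult_right_mono power_mono) (auto simp: power2_eq_square algebra_simps)
  finally show ?thesis by simp
qed

text \<open>Stationarity turns the recursion into an inequality for one number, which is solved
  after dividing by \<open>\<gamma>\<close>.\<close>

lemma uniform_obs_square:
  assumes g: "\<And>c. 0 \<le> g c" "\<And>c. g c \<le> 1"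
  shows "measure_pmf.expectation uniform (\<lambda>x. (obs g x)\<^sup>2) \<le> 1 / 2"
proof -
  let ?E = "measure_pmf.expectation uniform"
  have "?E (\<lambda>x. (obs g x)\<^sup>2) = ?E (step_mean (\<lambda>x. (obs g x)\<^sup>2))"
    using expectation_bind_step[of uniform] uniform_step
    by (simp add: set_uniform finite_arrangements)
  also have "\<dots> \<le> ?E (\<lambda>x. (1 - 2 * \<gamma>) * (obs g x)\<^sup>2 + \<gamma>)"
    by (intro integral_mono integrable_uniform step_mean_obs_square g)
  also have "\<dots> = (1 - 2 * \<gamma>) * ?E (\<lambda>x. (obs g x)\<^sup>2) + \<gamma>"
    by (subst Bochner_Integration.integral_add) (auto intro: integrable_uniform)
  finally have "\<gamma> * (2 * ?E (\<lambda>x. (obs g x)\<^sup>2)) \<le> \<gamma> * 1" by (simp add: algebra_simps)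
  then show ?thesis using gamma_pos mult_le_cancel_left_pos by fastforce
qed

section \<open>The lower bound for one graph\<close>

text \<open>With a mean \<open>\<mu> \<ge> 3\<close>, the event that the observable is at least
  \<open>\<mu> / 2\<close> in size has probability at least 7/9 under the law and at most 2/9 in
  equilibrium, a gap above 1/4.\<close>

lemma obs_at_mixing_time:
  assumes \<eta>: "\<eta> \<in> arrangements V" and g: "\<And>c. 0 \<le> g c" "\<And>c. g c \<le> 1"
  shows "(1 - \<gamma>) ^ mixing_time V E \<eta> * obs g \<eta> < 3"
proof (rule ccontr)
  let ?t = "mixing_time V E \<eta>"
  define \<mu> where "\<mu> = (1 - \<gamma>) ^ ?t * obs g \<eta>"
  assume "\<not> (1 - \<gamma>) ^ ?t * obs g \<eta> < 3"
  then have \<mu>: "\<mu> \<ge> 3" by (simp add: \<mu>_def)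
  then have "3 ^ 2 \<le> \<mu>\<^sup>2" by (intro power_mono) auto
  then have small: "(1 / 2) / (\<mu> / 2)\<^sup>2 \<le> 2 / 9"
    by (simp add: power2_eq_square field_simps)
  have bound: "v / (\<mu> / 2)\<^sup>2 \<le> 2 / 9" if "v \<le> 1 / 2" for v
    using that small by (meson divide_right_mono order_trans zero_le_power2)
  let ?P = "interchange_law E \<eta> ?t" and ?A = "{x. \<bar>obs g x\<bar> \<ge> \<mu> / 2}"
  have "measure_pmf.prob ?P {x. \<bar>obs g x - \<mu>\<bar> \<ge> \<mu> / 2} \<le>
      measure_pmf.variance ?P (obs g) / (\<mu> / 2)\<^sup>2"
    using measure_pmf.Chebyshev_inequality[of "obs g" ?P "\<mu> / 2"] \<mu> integrable_law
    by (simp add: expectation_obs \<mu>_def)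
  also have "\<dots> \<le> 2 / 9" by (intro bound variance_obs g)
  finally have dev: "measure_pmf.prob ?P {x. \<bar>obs g x - \<mu>\<bar> \<ge> \<mu> / 2} \<le> 2 / 9" .
  have "1 - measure_pmf.prob ?P ?A = measure_pmf.prob ?P (- ?A)"
    using measure_pmf.prob_compl[of ?A ?P] by (simp add: Compl_eq_Diff_UNIV)
  also have "\<dots> \<le> measure_pmf.prob ?P {x. \<bar>obs g x - \<mu>\<bar> \<ge> \<mu> / 2}"
    by (intro measure_pmf.finite_measure_mono) auto
  finally have "measure_pmf.prob ?P ?A \<ge> 7 / 9" using dev by simp
  moreover have "measure_pmf.prob uniform ?A \<le>
      measure_pmf.expectation uniform (\<lambda>x. (obs g x)\<^sup>2) / (\<mu> / 2)\<^sup>2"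
    using measure_pmf.second_moment_method[of "obs g" uniform "\<mu> / 2"] \<mu> integrable_uniform by simp
  moreover have "\<dots> \<le> 2 / 9" by (intro bound uniform_obs_square g)
  ultimately show False using mixing_time_separation[OF \<eta>, of ?A] by simp
qed

lemma norm1_at_mixing_time:
  assumes \<eta>: "\<eta> \<in> arrangements V"
  shows "(1 - \<gamma>) ^ mixing_time V E \<eta> * (\<Sum>v\<in>V. \<bar>\<xi> v\<bar>) < 6"
proof -
  \<comment> \<open>The inverse of \<open>\<eta>\<close> sends a card to its starting vertex. The
    initial value is then the sum of the positive parts of \<open>\<xi>\<close>, half the 1-norm
    because \<open>\<xi>\<close> sums to 0.\<close>
  define g where "g c = (if \<xi> (inv_into UNIV \<eta> c) > 0 then 1 else 0 :: real)" for c
  have "inj \<eta>" using \<eta> by (auto simp: arrangements_def permutes_inj)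
  then have "obs g \<eta> = (\<Sum>v\<in>V. (\<bar>\<xi> v\<bar> + \<xi> v) / 2)"
    unfolding obs_def by (intro sum.cong refl) (auto simp: g_def)
  also have "\<dots> = (\<Sum>v\<in>V. \<bar>\<xi> v\<bar>) / 2"
    by (simp add: sum_divide_distrib[symmetric] sum.distrib eigen_sum)
  finally have "obs g \<eta> = (\<Sum>v\<in>V. \<bar>\<xi> v\<bar>) / 2" .
  moreover have "(1 - \<gamma>) ^ mixing_time V E \<eta> * obs g \<eta> < 3"
    by (rule obs_at_mixing_time[OF \<eta>]) (simp_all add: g_def)
  ultimately show ?thesis by (simp only: times_divide_eq_right)
qed

lemma mixing_time_lower_bound:
  assumes \<eta>: "\<eta> \<in> arrangements V" and a: "a > 0"
    and norm1: "(\<Sum>v\<in>V. \<bar>\<xi> v\<bar>) \<ge> real (card V) powr a"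
    and large: "ln (real (card V)) \<ge> 2 * ln 6 / a"
  shows "inverse \<gamma> * ln (real (card V)) \<le> 4 / a * real (mixing_time V E \<eta>)"
proof -
  let ?n = "real (card V)" and ?t = "mixing_time V E \<eta>"
  have n: "?n > 0" using card_V_ge_2 by simp
  have "(1 - \<gamma>) ^ ?t * ?n powr a \<le> (1 - \<gamma>) ^ ?t * (\<Sum>v\<in>V. \<bar>\<xi> v\<bar>)"
    using norm1 gamma_le by (intro mult_left_mono) auto
  also have "\<dots> < 6" by (rule norm1_at_mixing_time[OF \<eta>])
  finally have "ln ((1 - \<gamma>) ^ ?t * ?n powr a) < ln 6"
    using n gamma_le by (subst ln_less_cancel_iff) auto
  then have *: "real ?t * ln (1 - \<gamma>) + a * ln ?n < ln 6"
    using n gamma_le by (simp add: ln_mult ln_realpow ln_powr)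
  \<comment> \<open>Here \<open>\<gamma> \<le> 1 / 2\<close> gives
    \<open>2 * \<gamma>^2 \<le> \<gamma>\<close>.\<close>
  have "- 2 * \<gamma> \<le> - \<gamma> - 2 * \<gamma>\<^sup>2"
    using gamma_pos gamma_le by (simp add: power2_eq_square)
  also have "\<dots> \<le> ln (1 - \<gamma>)"
    using gamma_pos gamma_le by (intro ln_one_minus_pos_lower_bound) auto
  finally have "real ?t * (- 2 * \<gamma>) \<le> real ?t * ln (1 - \<gamma>)" by (intro mult_left_mono) auto
  \<comment> \<open>The threshold in \<open>large\<close> is chosen so that \<open>ln 6\<close> uses
    up only half of \<open>a * ln n\<close>.\<close>
  moreover have "ln 6 \<le> a * ln ?n / 2" using large a by (simp add: field_simps)
  ultimately have "a * ln ?n \<le> 4 * \<gamma> * real ?t" using * by (simp add: algebra_simps)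
  then show ?thesis using a gamma_pos by (simp add: field_simps)
qed

end

section \<open>One constant for the whole sequence of graphs\<close>

theorem proposition1p2:
  fixes V :: "nat \<Rightarrow> 'v set"
    and E :: "nat \<Rightarrow> 'v set set"
    and \<eta>\<^sub>0 :: "nat \<Rightarrow> 'v \<Rightarrow> 'v"
    and \<gamma> :: "nat \<Rightarrow> real"
    and \<xi> :: "nat \<Rightarrow> 'v \<Rightarrow> real"
    and a :: real
  assumes graphs: "\<And>k. connected_simple_graph (V k) (E k)"
    and size: "filterlim (\<lambda>k. card (V k)) at_top sequentially"
    and initial: "\<And>k. \<eta>\<^sub>0 k \<in> arrangements (V k)"
    and gamma_small: "\<gamma> \<in> o(\<lambda>k. 1 / real (card (V k)))"
    and second: "\<And>k. second_largest_eigenvalue (V k) (E k) (1 - \<gamma> k)"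
    and eigen: "\<And>k. card_motion_eigenvector (V k) (E k) (1 - \<gamma> k) (\<xi> k)"
    and norm2: "\<And>k. sqrt (\<Sum>v\<in>V k. (\<xi> k v)\<^sup>2) = 1"
    and a_pos: "a > 0"
    and norm1: "\<And>k. (\<Sum>v\<in>V k. \<bar>\<xi> k v\<bar>) \<ge> real (card (V k)) powr a"
  shows "\<exists>C::real. \<forall>k. inverse (\<gamma> k) * ln (real (card (V k)))
           \<le> C * real (mixing_time (V k) (E k) (\<eta>\<^sub>0 k))"
proof -
  let ?n = "\<lambda>k. real (card (V k))" and ?T = "\<lambda>k. real (mixing_time (V k) (E k) (\<eta>\<^sub>0 k))"
  let ?L = "\<lambda>k. inverse (\<gamma> k) * ln (?n k)"
  have interchange: "interchange (V k) (E k)" if "\<gamma> k > 0" for k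
  proof
    show "E k \<noteq> {}"
    proof
      \<comment> \<open>Without edges, division by zero yields 0, so \<open>card_motion\<close> is
        the identity matrix; its eigenvalue 1 contradicts \<open>\<gamma> k > 0\<close>.\<close>
      assume E: "E k = {}"
      from eigen[of k] obtain u where u: "u \<in> V k" "\<xi> k u \<noteq> 0"
        "(\<Sum>v\<in>V k. card_motion (E k) u v * \<xi> k v) = (1 - \<gamma> k) * \<xi> k u"
        by (auto simp: card_motion_eigenvector_def)
      have "(\<Sum>v\<in>V k. card_motion (E k) u v * \<xi> k v) = (\<Sum>v\<in>V k. if u = v then \<xi> k v else 0)"
        by (intro sum.cong refl) (simp add: card_motion_def E)
      also have "\<dots> = \<xi> k u"
        using u graphs[of k] by (simp add: connected_simple_graph_def)
      finally show False using u that by simp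
    qed
  qed (rule graphs)
  have "\<forall>\<^sub>F k in sequentially. norm (\<gamma> k) \<le> 1 / 2 * norm (1 / ?n k)"
    using landau_o.smallD[OF gamma_small, of "1 / 2"] by simp
  \<comment> \<open>If \<open>card (V k) = 0\<close>, the convention \<open>1 / 0 = 0\<close> gives
    the bound.\<close>
  moreover have "1 / 2 * norm (1 / ?n k) \<le> 1 / 2" for k
    by (cases "card (V k)") auto
  ultimately have "\<forall>\<^sub>F k in sequentially. \<gamma> k \<le> 1 / 2"
    by (elim eventually_mono) (smt (verit) real_norm_def)
  moreover have "filterlim (\<lambda>k. ln (?n k)) at_top sequentially"
    by (intro filterlim_compose[OF ln_at_top] filterlim_compose[OF filterlim_real_sequentially] size)
  then have "\<forall>\<^sub>F k in sequentially. ln (?n k) \<ge> 2 * ln 6 / a"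
    by (simp add: filterlim_at_top)
  ultimately have "\<forall>\<^sub>F k in sequentially. \<gamma> k \<le> 1 / 2 \<and> ln (?n k) \<ge> 2 * ln 6 / a"
    by (rule eventually_conj)
  then obtain K where K: "\<And>k. k \<ge> K \<Longrightarrow> \<gamma> k \<le> 1 / 2 \<and> ln (?n k) \<ge> 2 * ln 6 / a"
    by (auto simp: eventually_sequentially)
  \<comment> \<open>\<open>D\<close> dominates the left-hand side for the finitely many
    \<open>k < K\<close>, where the mixing time is at least 1.\<close>
  define D where "D = (\<Sum>k<K. \<bar>?L k\<bar>)"
  define C where "C = 4 / a + D"
  have "D \<ge> 0" unfolding D_def by (intro sum_nonneg) auto
  then have C: "4 / a \<le> C" "D \<le> C" "0 \<le> C" unfolding C_def using a_pos by auto
  have "?L k \<le> C * ?T k" for k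
  proof (cases "\<gamma> k > 0")
    case False
    \<comment> \<open>For \<open>\<gamma> k \<le> 0\<close> the left-hand side is at most 0, as
      \<open>inverse 0 = 0\<close> and the logarithm is nonnegative.\<close>
    have "?n k \<ge> 1"
      using graphs[of k] by (simp add: connected_simple_graph_def Suc_le_eq card_gt_0_iff)
    then have "?L k \<le> 0" using False by (intro mult_nonpos_nonneg) auto
    also have "0 \<le> C * ?T k" using C by simp
    finally show ?thesis .
  next
    case True
    then interpret interchange "V k" "E k" by (rule interchange)
    show ?thesis
    proof (cases "k < K")
      case True
      then have "\<bar>?L k\<bar> \<le> D" unfolding D_def by (intro member_le_sum) auto
      then have "?L k \<le> C * 1" using C by simp
      also have "\<dots> \<le> C * ?T k"
        using C mixing_time_pos[OF initial] by (intro mult_left_mono) auto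
      finally show ?thesis .
    next
      case False
      then interpret interchange_eigen "V k" "E k" "\<xi> k" "\<gamma> k"
        using \<open>\<gamma> k > 0\<close> K[of k] eigen[of k] norm2[of k]
        by unfold_locales (auto simp: card_motion_eigenvector_def real_sqrt_eq_1_iff)
      have "?L k \<le> 4 / a * ?T k"
        using K[of k] False by (intro mixing_time_lower_bound initial a_pos norm1) auto
      also have "\<dots> \<le> C * ?T k" using C by (intro mult_right_mono) auto
      finally show ?thesis .
    qed
  qed
  then show ?thesis by blast
qed

end
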